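(* Let $d\ge 2$ be a constant. There is a randomized algorithm which, given the vertex set $U(\mathcal{H})$ of a $d$-uniform hypergraph $\mathcal{H}$ (whose hyperedges are unknown) that is promised to have a hitting set of size at most $k$, the positive integer $k$, and access to a GPISE oracle for $\mathcal{H}$, makes $\mathcal{O}(k^{d}\log k)$ GPISE queries and, with probability at least $1-1/k^{c}$ for some constant $c>0$, outputs a hitting set of $\mathcal{H}$ of size at most $k$.
   Context: A hitting set of $\mathcal{H}$ is a vertex set intersecting every hyperedge. The GPISE oracle takes as input $d$ pairwise disjoint non-empty subsets $A_1,\dots,A_d\subseteq U(\mathcal{H})$ and returns some hyperedge $\{u_1,\dots,u_d\}$ with $u_i\in A_i$ for all $i$ if one exists (an arbitrary such hyperedge), and NULL otherwise. Only oracle queries are counted. *)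

theory Defs
  imports "HOL-Probability.Probability" "HOL-Library.Landau_Symbols"
begin

definition uniform_hypergraph :: "nat \<Rightarrow> 'v set \<Rightarrow> 'v set set \<Rightarrow> bool" where
  "uniform_hypergraph d U H \<longleftrightarrow> finite U \<and> (\<forall>E\<in>H. E \<subseteq> U \<and> card E = d)"

definition hitting_set :: "'v set \<Rightarrow> 'v set set \<Rightarrow> 'v set \<Rightarrow> bool" where
  "hitting_set U H S \<longleftrightarrow> S \<subseteq> U \<and> (\<forall>E\<in>H. E \<inter> S \<noteq> {})"

definition gpise_query :: "nat \<Rightarrow> 'v set \<Rightarrow> 'v set list \<Rightarrow> bool" where
  "gpise_query d U A \<longleftrightarrow> length A = d \<and> (\<forall>i<d. A ! i \<noteq> {} \<and> A ! i \<subseteq> U) \<and>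
     (\<forall>i<d. \<forall>j<d. i \<noteq> j \<longrightarrow> A ! i \<inter> A ! j = {})"

text \<open>The edge is \<open>{u\<^sub>1, \<dots>, u\<^sub>d}\<close> with \<open>u\<^sub>i \<in> A\<^sub>i\<close>
  for all \<open>i\<close>.\<close>

definition edge_across :: "'v set list \<Rightarrow> 'v set \<Rightarrow> bool" where
  "edge_across A E \<longleftrightarrow> (\<exists>u. E = set u \<and> list_all2 (\<in>) u A)"

text \<open>The oracle's choice among the admissible hyperedges is arbitrary. In particular it may
  depend on the queries made so far (the first argument, most recent query first), so that
  repeating a query need not repeat the answer; an oracle that is a function of the query alone is
  the special case that ignores this argument. \<open>None\<close> is the answer NULL. Nothing is
  assumed about the answer to an illegal query.\<close>

definition gpise_oracle ::
  "nat \<Rightarrow> 'v set \<Rightarrow> 'v set set \<Rightarrow> ('v set list list \<Rightarrow> 'v set list \<Rightarrow> 'v set option) \<Rightarrow> bool" where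
  "gpise_oracle d U H ora \<longleftrightarrow> (\<forall>hist A. gpise_query d U A \<longrightarrow>
     (case ora hist A of
        Some E \<Rightarrow> E \<in> H \<and> edge_across A E
      | None \<Rightarrow> \<not> (\<exists>E\<in>H. edge_across A E)))"

text \<open>Randomized adaptive query algorithms: a program outputs a vertex set, or queries the oracle
  and continues depending on the answer, or draws a random number and continues depending on it.
  Computation between queries is free. Every branch of a program is finite.\<close>

datatype 'v prog =
    Output "'v set"
  | Query "'v set list" "'v set option \<Rightarrow> 'v prog"
  | Sample "nat pmf" "nat \<Rightarrow> 'v prog"

text \<open>Joint distribution of the output and the list of all queries made, starting from the query
  history \<open>hist\<close>.\<close>

primrec run ::
  "('v set list list \<Rightarrow> 'v set list \<Rightarrow> 'v set option) \<Rightarrow> 'v prog \<Rightarrow> 'v set list list \<Rightarrow>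
   ('v set \<times> 'v set list list) pmf" where
  "run ora (Output S) hist = return_pmf (S, hist)"
| "run ora (Query A f) hist = run ora (f (ora hist A)) (A # hist)"
| "run ora (Sample p f) hist = bind_pmf p (\<lambda>x. run ora (f x) hist)"

end

theory Submission
  imports Defs
begin

text \<open>
  The algorithm is adaptive. Given the hyperedges \<open>F\<close> found so far, pick any \<open>X\<close> of size at most
  \<open>k\<close> that hits \<open>F\<close>, and look for a hyperedge inside \<open>U - X\<close> by querying the colour classes of
  \<open>O(log k)\<close> random \<open>d\<close>-colourings of \<open>U - X\<close>: if one exists, a single colouring separates its vertices in
  the right order with probability at least \<open>1 / d ^ d\<close>. Either a new hyperedge is found, or
  \<open>X\<close> is output. The hyperedges \<open>E\<close> and sets \<open>X\<close> of successive stages form a skew system of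
  set pairs: \<open>X\<close> misses the hyperedge of its own stage and meets all earlier ones. By the
  skew version of Bollobas' inequality there are \<open>O(k ^ d)\<close> stages, and a union bound over the stages
  controls the failure probability.
\<close>

section \<open>Skew set pairs\<close>

text \<open>Gaussian elimination: an equation \<open>e\<close> with pivot \<open>p\<close> removes
  the unknown \<open>p\<close> from the other equations, and the induction hypothesis solves the
  reduced system in the unknowns \<open>J\<close>.\<close>

lemma underdetermined_system_nontrivial:
  fixes u :: "'i \<Rightarrow> 'e \<Rightarrow> 'a::field"
  assumes "finite N" "finite I" "card N < card I"
  shows "\<exists>\<alpha>. (\<exists>i\<in>I. \<alpha> i \<noteq> 0) \<and> (\<forall>e\<in>N. (\<Sum>i\<in>I. \<alpha> i * u i e) = 0)"
  using assms
proof (induction N arbitrary: I u rule: finite_induct)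
  case empty
  then have "I \<noteq> {}" by auto
  then show ?case by (intro exI[of _ "\<lambda>_. 1"]) auto
next
  case (insert e N)
  show ?case
  proof (cases "\<forall>i\<in>I. u i e = 0")
    case True
    obtain \<alpha> where "\<exists>i\<in>I. \<alpha> i \<noteq> 0" "\<forall>e\<in>N. (\<Sum>i\<in>I. \<alpha> i * u i e) = 0"
      using insert.IH[of I u] insert.prems insert.hyps by auto
    with True show ?thesis by (intro exI[of _ \<alpha>]) auto
  next
    case False
    then obtain p where p: "p \<in> I" "u p e \<noteq> 0" by auto
    define J where "J = I - {p}"
    have fin: "finite J" and I: "I = insert p J" "p \<notin> J"
      using insert.prems p unfolding J_def by auto
    have "card N < card J" using insert.prems insert.hyps fin I by simp
    then obtain \<beta> where nz: "\<exists>i\<in>J. \<beta> i \<noteq> 0"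
      and \<beta>: "\<forall>f\<in>N. (\<Sum>i\<in>J. \<beta> i * (u i f - u i e / u p e * u p f)) = 0"
      using insert.IH[of J "\<lambda>i f. u i f - u i e / u p e * u p f"] fin by auto
    \<comment> \<open>Once the other unknowns are \<open>\<beta>\<close>, equation \<open>e\<close>
      forces the value \<open>- s\<close> on the pivot unknown.\<close>
    define s where "s = (\<Sum>i\<in>J. \<beta> i * u i e) / u p e"
    define \<alpha> where "\<alpha> = \<beta>(p := - s)"
    have sum_\<alpha>: "(\<Sum>i\<in>I. \<alpha> i * u i f) = (\<Sum>i\<in>J. \<beta> i * u i f) - s * u p f" for f
    proof -
      have "(\<Sum>i\<in>J. \<alpha> i * u i f) = (\<Sum>i\<in>J. \<beta> i * u i f)"
        using I by (intro sum.cong) (auto simp: \<alpha>_def)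
      then show ?thesis using I fin by (simp add: \<alpha>_def)
    qed
    have "(\<Sum>i\<in>I. \<alpha> i * u i f) = 0" if "f \<in> insert e N" for f
    proof (cases "f = e")
      case True
      then show ?thesis using p by (simp add: sum_\<alpha> s_def)
    next
      case False
      then have "f \<in> N" using that by simp
      then have "0 = (\<Sum>i\<in>J. \<beta> i * (u i f - u i e / u p e * u p f))" using \<beta> by simp
      also have "\<dots> = (\<Sum>i\<in>J. \<beta> i * u i f) - s * u p f"
        by (simp add: s_def right_diff_distrib sum_subtractf sum_distrib_right sum_divide_distrib
            mult.assoc)
      finally show ?thesis by (simp add: sum_\<alpha>)
    qed
    moreover have "\<exists>i\<in>I. \<alpha> i \<noteq> 0" using nz I by (auto simp: \<alpha>_def)
    ultimately show ?thesis by blast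
  qed
qed

text \<open>A factorization through \<open>N\<close> forces a linear dependency between the rows as
  soon as \<open>m > card N\<close>. In the column of its last nonzero coefficient only the diagonal
  term survives: earlier rows vanish there by \<open>tri\<close>, later rows have coefficient
  zero.\<close>

lemma triangular_factorization_rank:
  fixes M :: "nat \<Rightarrow> nat \<Rightarrow> 'a::field"
  assumes "finite N"
    and fact: "\<And>i j. i < m \<Longrightarrow> j < m \<Longrightarrow> M i j = (\<Sum>e\<in>N. u i e * w e j)"
    and diag: "\<And>i. i < m \<Longrightarrow> M i i \<noteq> 0"
    and tri: "\<And>i j. i < j \<Longrightarrow> j < m \<Longrightarrow> M i j = 0"
  shows "m \<le> card N"
proof (rule ccontr)
  assume "\<not> m \<le> card N"
  then obtain \<alpha> where nz: "\<exists>i\<in>{..<m}. \<alpha> i \<noteq> 0"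
    and \<alpha>: "\<forall>e\<in>N. (\<Sum>i<m. \<alpha> i * u i e) = 0"
    using underdetermined_system_nontrivial[of N "{..<m}" u] assms(1) by auto
  define j where "j = Max {i. i < m \<and> \<alpha> i \<noteq> 0}"
  have fin: "finite {i. i < m \<and> \<alpha> i \<noteq> 0}" by simp
  have "{i. i < m \<and> \<alpha> i \<noteq> 0} \<noteq> {}" using nz by auto
  from Max_in[OF fin this] have j: "j < m" "\<alpha> j \<noteq> 0" unfolding j_def by simp_all
  have above: "\<alpha> i = 0" if "i < m" "j < i" for i
    using Max_ge[OF fin, of i] that unfolding j_def by (metis (mono_tags, lifting) mem_Collect_eq not_le)
  have "0 = (\<Sum>e\<in>N. (\<Sum>i<m. \<alpha> i * u i e) * w e j)" using \<alpha> by simp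
  also have "\<dots> = (\<Sum>i<m. \<alpha> i * M i j)"
    using j fact by (simp add: sum_distrib_right sum_distrib_left mult.assoc sum.swap[of _ N])
  also have "\<dots> = (\<Sum>i<m. if i = j then \<alpha> j * M j j else 0)"
    using above tri j by (intro sum.cong refl) (metis lessThan_iff linorder_neqE_nat mult_zero_left mult_zero_right)
  also have "\<dots> = \<alpha> j * M j j" using j by simp
  finally show False using j diag by simp
qed

text \<open>With the vertices as distinct reals, \<open>M i j = (\<Prod>a\<in>A i. \<Prod>b\<in>B j. a - b)\<close> is triangular.
  Expanding the \<open>d\<close> factors over \<open>a\<close>, each a polynomial of degree at most \<open>k\<close>, bounds its rank.\<close>

lemma skew_set_pairs_bound:
  fixes A B :: "nat \<Rightarrow> 'v set"
  assumes A: "\<And>i. i < m \<Longrightarrow> finite (A i) \<and> card (A i) = d"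
    and B: "\<And>i. i < m \<Longrightarrow> finite (B i) \<and> card (B i) \<le> k"
    and disj: "\<And>i. i < m \<Longrightarrow> A i \<inter> B i = {}"
    and meet: "\<And>i j. i < j \<Longrightarrow> j < m \<Longrightarrow> A i \<inter> B j \<noteq> {}"
  shows "m \<le> (k + 1) ^ d"
proof -
  have "finite (\<Union>i<m. A i \<union> B i)" using A B by auto
  then obtain t0 :: "'v \<Rightarrow> nat" where t0: "inj_on t0 (\<Union>i<m. A i \<union> B i)"
    using finite_imp_inj_to_nat_seg by metis
  define t where "t v = real (t0 v)" for v
  have t: "t a = t b \<longleftrightarrow> a = b" if "i < m" "j < m" "a \<in> A i" "b \<in> B j" for a b i j
    using t0 that unfolding t_def inj_on_def by (auto; blast)
  have "\<exists>h. bij_betw h {..<d} (A i)" if "i < m" for i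
    using ex_bij_betw_nat_finite[of "A i"] A[OF that] by (auto simp: atLeast0LessThan)
  then obtain a where a: "\<And>i. i < m \<Longrightarrow> bij_betw (a i) {..<d} (A i)" by metis
  define Q where "Q j = (\<Prod>b\<in>B j. [:- t b, 1:])" for j
  define M where "M i j = (\<Prod>l<d. poly (Q j) (t (a i l)))" for i j
  \<comment> \<open>Exponent vectors of the monomials in \<open>d\<close> variables with each
    exponent at most \<open>k\<close>; there are \<open>(k + 1) ^ d\<close> of them.\<close>
  define N where "N = PiE {..<d} (\<lambda>_. {..k})"
  have deg: "degree (Q j) \<le> k" if "j < m" for j
    using degree_prod_sum_le[of "B j" "\<lambda>b. [:- t b, 1:]"] B[OF that] by (auto simp: Q_def)
  have M_eq: "M i j = (\<Prod>v\<in>A i. \<Prod>b\<in>B j. t v - t b)" if "i < m" for i j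
    using prod.reindex_bij_betw[OF a[OF that], of "\<lambda>v. \<Prod>b\<in>B j. t v - t b"]
    by (simp add: M_def Q_def poly_prod)
  have "m \<le> card N"
  proof (rule triangular_factorization_rank)
    show "finite N" by (auto simp: N_def intro: finite_PiE)
    show "M i j = (\<Sum>e\<in>N. (\<Prod>l<d. t (a i l) ^ e l) * (\<Prod>l<d. coeff (Q j) (e l)))"
      if "i < m" "j < m" for i j
    proof -
      have "poly (Q j) x = (\<Sum>e\<le>k. x ^ e * coeff (Q j) e)" for x
        using poly_as_sum_of_monoms'[OF deg[OF that(2)]]
        by (metis (no_types, lifting) mult.commute poly_monom poly_sum sum.cong)
      \<comment> \<open>Distributing the product over the \<open>d\<close> sums gives one term per
        exponent vector: a monomial depending only on \<open>i\<close> times a product of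
        coefficients depending only on \<open>j\<close>.\<close>
      then show ?thesis
        by (simp add: M_def N_def prod_sum_PiE prod.distrib)
    qed
    show "M i i \<noteq> 0" if "i < m" for i
      using M_eq[OF that] A B disj t that by (auto simp: disjoint_iff)
    show "M i j = 0" if ij: "i < j" "j < m" for i j
    proof -
      obtain v where "v \<in> A i" "v \<in> B j" using meet[OF ij] by auto
      moreover have "finite (A i)" "finite (B j)" using A B ij by auto
      ultimately have "(\<Prod>v\<in>A i. \<Prod>b\<in>B j. t v - t b) = 0" by (auto intro!: bexI[of _ v])
      then show ?thesis using M_eq ij by simp
    qed
  qed
  then show ?thesis by (simp add: N_def card_PiE)
qed

section \<open>Random colourings\<close>

text \<open>A class may be empty, so a colouring need not yield a legal query;
  \<open>find_edge\<close> tests for this.\<close>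

definition colour_classes :: "nat \<Rightarrow> 'v set \<Rightarrow> ('v \<Rightarrow> nat) \<Rightarrow> 'v set list" where
  "colour_classes d W \<phi> = map (\<lambda>i. {w\<in>W. \<phi> w = i}) [0..<d]"

definition colourings :: "nat \<Rightarrow> 'v set \<Rightarrow> ('v \<Rightarrow> nat) set" where
  "colourings d W = PiE W (\<lambda>_. {..<d})"

text \<open>Programs can only sample natural numbers, so colourings are drawn through an enumeration.\<close>

definition nth_colouring :: "nat \<Rightarrow> 'v set \<Rightarrow> nat \<Rightarrow> 'v \<Rightarrow> nat" where
  "nth_colouring d W = (SOME h. bij_betw h {..<card (colourings d W)} (colourings d W))"

definition colouring_index :: "nat \<Rightarrow> 'v set \<Rightarrow> nat pmf" where
  "colouring_index d W = pmf_of_set {..<card (colourings d W)}"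

lemma finite_colourings: "finite W \<Longrightarrow> finite (colourings d W)"
  by (auto simp: colourings_def intro: finite_PiE)

lemma card_colourings: "finite W \<Longrightarrow> card (colourings d W) = d ^ card W"
  by (simp add: colourings_def card_PiE)

text \<open>A uniform index passed through a bijective enumeration is a uniform colouring, which
  turns probabilities into counts.\<close>

lemma prob_colouring:
  assumes "finite W" "d > 0"
  shows "measure_pmf.prob (colouring_index d W) {x. nth_colouring d W x \<in> G} =
    card (colourings d W \<inter> G) / d ^ card W"
proof -
  let ?n = "card (colourings d W)"
  have "\<exists>h. bij_betw h {..<?n} (colourings d W)"
    using ex_bij_betw_nat_finite[OF finite_colourings[OF assms(1)]] by (simp add: atLeast0LessThan)
  then have bij: "bij_betw (nth_colouring d W) {..<?n} (colourings d W)"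
    unfolding nth_colouring_def by (rule someI_ex)
  have pos: "?n > 0" using assms by (simp add: card_colourings)
  have "bij_betw (nth_colouring d W) ({..<?n} \<inter> {x. nth_colouring d W x \<in> G}) (colourings d W \<inter> G)"
    using bij unfolding bij_betw_def by (auto intro: inj_on_subset)
  then have "card ({..<?n} \<inter> {x. nth_colouring d W x \<in> G}) = card (colourings d W \<inter> G)"
    by (rule bij_betw_same_card)
  moreover have "{..<?n} \<noteq> {}" using pos by (metis lessThan_empty_iff less_numeral_extra(3))
  ultimately show ?thesis
    unfolding colouring_index_def using assms by (simp add: measure_pmf_of_set card_colourings)
qed

lemma gpise_query_mono: "gpise_query d W A \<Longrightarrow> W \<subseteq> U \<Longrightarrow> gpise_query d U A"
  unfolding gpise_query_def by blast

lemma edge_across_subset: "gpise_query d W A \<Longrightarrow> edge_across A E \<Longrightarrow> E \<subseteq> W"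
  by (force simp: gpise_query_def edge_across_def list_all2_conv_all_nth in_set_conv_nth)

text \<open>Giving colour \<open>i\<close> to the \<open>i\<close>-th vertex of \<open>E\<close>, in
  one fixed enumeration, prescribes \<open>d\<close> independent uniform colours. The query is then
  legal, since every class contains a vertex of \<open>E\<close>.\<close>

lemma prob_edge_separated:
  assumes "finite W" "E \<subseteq> W" "card E = d" "d > 0"
  shows "measure_pmf.prob (colouring_index d W)
    {x. gpise_query d W (colour_classes d W (nth_colouring d W x)) \<and>
        edge_across (colour_classes d W (nth_colouring d W x)) E} \<ge> 1 / real d ^ d"
proof -
  have finE: "finite E" using assms finite_subset by blast
  obtain v where v: "bij_betw v {..<d} E"
    using ex_bij_betw_nat_finite[OF finE] assms by (auto simp: atLeast0LessThan)
  define c where "c = the_inv_into {..<d} v"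
  have c: "i < d \<Longrightarrow> v i \<in> E \<and> c (v i) = i" for i
    using v unfolding c_def bij_betw_def by (auto simp: the_inv_into_f_f)
  have c': "w \<in> E \<Longrightarrow> c w < d" for w
    using v c by (auto simp: bij_betw_def)
  define G where "G = {\<phi>. gpise_query d W (colour_classes d W \<phi>) \<and> edge_across (colour_classes d W \<phi>) E}"
  define P where "P = PiE W (\<lambda>w. if w \<in> E then {c w} else {..<d})"
  have "P \<subseteq> colourings d W \<inter> G"
  proof
    fix \<phi> assume "\<phi> \<in> P"
    then have \<phi>: "\<phi> (v i) = i" "v i \<in> W" if "i < d" for i
      using c[OF that] assms(2) by (auto simp: P_def PiE_iff; metis subsetD singletonD)+
    have "\<phi> \<in> colourings d W"
      using \<open>\<phi> \<in> P\<close> c' by (auto simp: P_def colourings_def PiE_iff split: if_splits)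
    moreover have "gpise_query d W (colour_classes d W \<phi>)"
      using \<phi> by (auto simp: gpise_query_def colour_classes_def)
    moreover have "edge_across (colour_classes d W \<phi>) E"
      unfolding edge_across_def
    proof (intro exI conjI)
      show "E = set (map v [0..<d])" using v by (simp add: bij_betw_def atLeast0LessThan)
      show "list_all2 (\<in>) (map v [0..<d]) (colour_classes d W \<phi>)"
        using \<phi> by (simp add: list_all2_conv_all_nth colour_classes_def)
    qed
    ultimately show "\<phi> \<in> colourings d W \<inter> G" by (simp add: G_def)
  qed
  then have "card P \<le> card (colourings d W \<inter> G)"
    using finite_colourings assms by (intro card_mono) auto
  moreover have "card P = d ^ card (W - E)"
  proof -
    have "card P = (\<Prod>w\<in>W. if w \<in> E then 1 else d)"
      using assms by (auto simp: P_def card_PiE intro: prod.cong)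
    also have "\<dots> = d ^ card (W - E)"
      using assms by (simp add: prod.If_cases Diff_eq)
    finally show ?thesis .
  qed
  moreover have "card W = card (W - E) + d"
    using assms finE by (metis card_Diff_subset card_mono le_add_diff_inverse2)
  ultimately have "real (d ^ card (W - E)) / d ^ card W \<le> card (colourings d W \<inter> G) / d ^ card W"
    by (intro divide_right_mono) auto
  also have "\<dots> = measure_pmf.prob (colouring_index d W) {x. nth_colouring d W x \<in> G}"
    using assms by (simp add: prob_colouring)
  finally show ?thesis
    using \<open>card W = card (W - E) + d\<close> assms by (simp add: G_def power_add)
qed

section \<open>Searching for an edge inside a vertex set\<close>

text \<open>Written with a continuation \<open>g\<close>, since programs have no sequential
  composition. The number counts colourings tried, so an illegal one uses up a try without a query;
  \<open>g None\<close> means that all tries failed.\<close>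

primrec find_edge :: "nat \<Rightarrow> 'v set \<Rightarrow> nat \<Rightarrow> ('v set option \<Rightarrow> 'v prog) \<Rightarrow> 'v prog" where
  "find_edge d W 0 g = g None"
| "find_edge d W (Suc n) g = Sample (colouring_index d W) (\<lambda>x.
     let A = colour_classes d W (nth_colouring d W x) in
     if gpise_query d W A
     then Query A (\<lambda>r. case r of None \<Rightarrow> find_edge d W n g | Some E \<Rightarrow> g (Some E))
     else find_edge d W n g)"

lemma oracle_Some:
  assumes "gpise_oracle d U H ora" "W \<subseteq> U" "gpise_query d W A" "ora hist A = Some E"
  shows "E \<in> H \<and> E \<subseteq> W"
proof -
  have "gpise_query d U A" using gpise_query_mono[OF assms(3,2)] .
  then have "case ora hist A of Some E \<Rightarrow> E \<in> H \<and> edge_across A E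
      | None \<Rightarrow> \<not> (\<exists>E\<in>H. edge_across A E)"
    using assms(1) unfolding gpise_oracle_def by blast
  then show ?thesis using assms(4) edge_across_subset[OF assms(3)] by simp
qed

lemma oracle_None:
  assumes "gpise_oracle d U H ora" "W \<subseteq> U" "gpise_query d W A" "E \<in> H" "edge_across A E"
  shows "ora hist A \<noteq> None"
proof
  assume "ora hist A = None"
  moreover have "gpise_query d U A" using gpise_query_mono[OF assms(3,2)] .
  then have "case ora hist A of Some E \<Rightarrow> E \<in> H \<and> edge_across A E
      | None \<Rightarrow> \<not> (\<exists>E\<in>H. edge_across A E)"
    using assms(1) unfolding gpise_oracle_def by blast
  ultimately show False using assms(4,5) by auto
qed

text \<open>Reduces statements about every possible run to the continuation: \<open>r\<close> is the
  search result and \<open>Q\<close> the queries spent on it.\<close>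

lemma find_edge_support:
  assumes "gpise_oracle d U H ora" "W \<subseteq> U"
    and "x \<in> set_pmf (run ora (find_edge d W n g) hist)"
  shows "\<exists>r Q. x \<in> set_pmf (run ora (g r) (Q @ hist)) \<and> length Q \<le> n \<and>
    (\<forall>A\<in>set Q. gpise_query d U A) \<and> (\<forall>E. r = Some E \<longrightarrow> E \<in> H \<and> E \<subseteq> W)"
  using assms(3)
proof (induction n arbitrary: hist)
  case 0
  then show ?case by (intro exI[of _ None] exI[of _ "[]"]) auto
next
  case (Suc n)
  then obtain y where y: "x \<in> set_pmf (run ora
      (let A = colour_classes d W (nth_colouring d W y) in
       if gpise_query d W A
       then Query A (\<lambda>r. case r of None \<Rightarrow> find_edge d W n g | Some E \<Rightarrow> g (Some E))
       else find_edge d W n g) hist)" by auto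
  define A where "A = colour_classes d W (nth_colouring d W y)"
  show ?case
  proof (cases "gpise_query d W A")
    case False
    then have "x \<in> set_pmf (run ora (find_edge d W n g) hist)" using y by (simp add: A_def Let_def)
    from Suc.IH[OF this] show ?thesis using le_SucI by blast
  next
    case True
    note legal = gpise_query_mono[OF True assms(2)]
    show ?thesis
    proof (cases "ora hist A")
      case None
      then have "x \<in> set_pmf (run ora (find_edge d W n g) (A # hist))"
        using y True by (simp add: A_def Let_def)
      from Suc.IH[OF this] obtain r Q where
        "x \<in> set_pmf (run ora (g r) (Q @ A # hist))" "length Q \<le> n"
        "\<forall>A\<in>set Q. gpise_query d U A" "\<forall>E. r = Some E \<longrightarrow> E \<in> H \<and> E \<subseteq> W" by blast
      \<comment> \<open>Histories list the most recent query first, so the earlier query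
        \<open>A\<close> goes to the end of \<open>Q\<close>.\<close>
      then show ?thesis using legal by (intro exI[of _ r] exI[of _ "Q @ [A]"]) auto
    next
      case (Some E)
      then have "x \<in> set_pmf (run ora (g (Some E)) ([A] @ hist))"
        using y True by (simp add: A_def Let_def)
      then show ?thesis using legal oracle_Some[OF assms(1,2) True Some]
        by (intro exI[of _ "Some E"] exI[of _ "[A]"]) auto
    qed
  qed
qed

text \<open>Averaging over the first draw: the excess \<open>e\<close> is paid only outside the good
  event \<open>G\<close>.\<close>

lemma prob_bind_pmf_le:
  assumes "\<And>x. measure_pmf.prob (f x) B \<le> b + (if x \<in> G then 0 else e)"
    and "e \<ge> 0" "b \<ge> 0" "measure_pmf.prob p G \<ge> q"
  shows "measure_pmf.prob (bind_pmf p f) B \<le> b + (1 - q) * e"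
proof -
  have "measure_pmf.prob (bind_pmf p f) B = measure_pmf.expectation p (\<lambda>x. measure_pmf.prob (f x) B)"
    unfolding measure_pmf_bind
    by (rule measure_pmf.measure_bind[where N = "count_space UNIV"])
      (auto simp: measure_pmf_in_subprob_algebra)
  also have "\<dots> \<le> measure_pmf.expectation p (\<lambda>x. b + e * indicator (- G) x)"
  proof (rule integral_mono)
    show "integrable p (\<lambda>x. measure_pmf.prob (f x) B)"
      by (rule measure_pmf.integrable_const_bound[where B = 1]) auto
    show "integrable p (\<lambda>x. b + e * indicator (- G) x)"
      using assms(2,3) by (intro measure_pmf.integrable_const_bound[where B = "b + e"])
        (auto simp: indicator_def)
    show "measure_pmf.prob (f x) B \<le> b + e * indicator (- G) x" for x
      using assms(1)[of x] by (auto simp: indicator_def split: if_splits)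
  qed
  also have "\<dots> = b + e * measure_pmf.prob p (- G)"
    by (subst Bochner_Integration.integral_add) (auto simp: measure_pmf.emeasure_eq_measure)
  also have "measure_pmf.prob p (- G) = 1 - measure_pmf.prob p G"
    using measure_pmf.prob_compl[of G p] by (simp add: Compl_eq_Diff_UNIV)
  also have "b + e * (1 - measure_pmf.prob p G) \<le> b + e * (1 - q)"
    using assms by (intro add_left_mono mult_left_mono) auto
  finally show ?thesis by (simp add: mult.commute)
qed

text \<open>\<open>B\<close> is the failure event. The bound \<open>b\<close> must hold for every
  edge and history, as the oracle may pick its answer adversarially; the second summand covers the
  runs in which all \<open>n\<close> colourings fail to separate the fixed edge
  \<open>E\<close>.\<close>

lemma find_edge_prob:
  assumes ora: "gpise_oracle d U H ora" and U: "uniform_hypergraph d U H" and W: "W \<subseteq> U"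
    and d: "d > 0" and E: "E \<in> H" "E \<subseteq> W"
    and b: "\<And>E hist. E \<in> H \<Longrightarrow> E \<subseteq> W \<Longrightarrow> measure_pmf.prob (run ora (g (Some E)) hist) B \<le> b"
  shows "measure_pmf.prob (run ora (find_edge d W n g) hist) B \<le> b + (1 - 1 / real d ^ d) ^ n"
proof (induction n arbitrary: hist)
  have b0: "0 \<le> b" using order_trans[OF measure_nonneg b[OF E]] by simp
  {
    case 0
    \<comment> \<open>With no tries left the claimed bound is \<open>b + 1\<close>, so nothing has
      to be known about \<open>g None\<close>.\<close>
    show ?case using b0 by (simp add: add_increasing)
  next
    case (Suc n)
    let ?A = "\<lambda>x. colour_classes d W (nth_colouring d W x)"
    let ?G = "{x. gpise_query d W (?A x) \<and> edge_across (?A x) E}"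
    let ?e = "(1 - 1 / real d ^ d) ^ n :: real"
    have "1 / real d ^ d \<le> (1::real)" using d by simp
    then have e0: "0 \<le> ?e" by simp
    have fin: "finite W" and card: "card E = d"
      using U W E unfolding uniform_hypergraph_def by (auto intro: finite_subset)
    have *: "measure_pmf.prob (run ora
        (let A = ?A x in
         if gpise_query d W A
         then Query A (\<lambda>r. case r of None \<Rightarrow> find_edge d W n g | Some E \<Rightarrow> g (Some E))
         else find_edge d W n g) hist) B \<le> b + (if x \<in> ?G then 0 else ?e)" for x
    proof (cases "gpise_query d W (?A x)")
      case False
      then show ?thesis using Suc.IH by (simp add: Let_def)
    next
      case True
      show ?thesis
      proof (cases "ora hist (?A x)")
        case None
        \<comment> \<open>If the colouring separates \<open>E\<close>, the oracle must answer with
          some edge, though possibly not \<open>E\<close> itself.\<close>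
        then have "x \<notin> ?G" using oracle_None[OF ora W True E(1)] by blast
        then show ?thesis using True None Suc.IH by (simp add: Let_def)
      next
        case (Some E')
        have "measure_pmf.prob (run ora (g (Some E')) (?A x # hist)) B \<le> b"
          using b oracle_Some[OF ora W True Some] by blast
        then show ?thesis using True Some e0 by (simp add: Let_def)
      qed
    qed
    have "measure_pmf.prob (run ora (find_edge d W (Suc n) g) hist) B \<le> b + (1 - 1 / real d ^ d) * ?e"
      unfolding find_edge.simps run.simps
      using prob_bind_pmf_le[OF * e0 b0 prob_edge_separated[OF fin E(2) card d]] .
    then show ?case by simp
  }
qed

section \<open>The algorithm\<close>

text \<open>The choice depends only on data known to the algorithm, not on \<open>H\<close>;
  computing it costs no queries.\<close>

definition small_hitting_set :: "'v set \<Rightarrow> nat \<Rightarrow> 'v set set \<Rightarrow> 'v set" where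
  "small_hitting_set U k F = (SOME X. hitting_set U F X \<and> card X \<le> k)"

text \<open>The argument \<open>m\<close> of the recursion bounds the remaining stages.
  \<open>Output {}\<close> is a dummy: with \<open>(k + 1) ^ d + 1\<close> stages available from the
  start, the promise on \<open>H\<close> keeps it from being reached.\<close>

primrec refine :: "nat \<Rightarrow> 'v set \<Rightarrow> nat \<Rightarrow> nat \<Rightarrow> nat \<Rightarrow> 'v set set \<Rightarrow> 'v prog" where
  "refine d U k n 0 F = Output {}"
| "refine d U k n (Suc m) F = find_edge d (U - small_hitting_set U k F) n
     (\<lambda>r. case r of None \<Rightarrow> Output (small_hitting_set U k F)
                  | Some E \<Rightarrow> refine d U k n m (insert E F))"

lemma small_hitting_set:
  assumes "hitting_set U H S" "card S \<le> k" "F \<subseteq> H"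
  shows "hitting_set U F (small_hitting_set U k F)" "card (small_hitting_set U k F) \<le> k"
proof -
  have "\<exists>X. hitting_set U F X \<and> card X \<le> k"
    using assms by (intro exI[of _ S]) (auto simp: hitting_set_def)
  from someI_ex[OF this]
  show "hitting_set U F (small_hitting_set U k F)" "card (small_hitting_set U k F) \<le> k"
    unfolding small_hitting_set_def by auto
qed

lemma refine_support:
  assumes "gpise_oracle d U H ora" "(S, hist') \<in> set_pmf (run ora (refine d U k n m F) hist)"
    and "\<forall>A\<in>set hist. gpise_query d U A"
  shows "length hist' \<le> length hist + m * n \<and> (\<forall>A\<in>set hist'. gpise_query d U A)"
  using assms(2,3)
proof (induction m arbitrary: F hist)
  case 0
  then show ?case by simp
next
  case (Suc m)
  let ?X = "small_hitting_set U k F"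
  obtain r Q where
    r: "(S, hist') \<in> set_pmf (run ora (case r of None \<Rightarrow> Output ?X
        | Some E \<Rightarrow> refine d U k n m (insert E F)) (Q @ hist))"
    and Q: "length Q \<le> n" "\<forall>A\<in>set Q. gpise_query d U A"
    using find_edge_support[OF assms(1) Diff_subset Suc.prems(1)[unfolded refine.simps]] by blast
  show ?case
  proof (cases r)
    case None
    then show ?thesis using r Q Suc.prems(2) by auto
  next
    case (Some E)
    then have "length hist' \<le> length (Q @ hist) + m * n \<and> (\<forall>A\<in>set hist'. gpise_query d U A)"
      using r Q Suc.prems(2) by (intro Suc.IH[of "insert E F" "Q @ hist"]) auto
    then show ?thesis using Q by simp
  qed
qed

text \<open>\<open>E\<close> and \<open>X\<close> record the \<open>l\<close> completed stages as a
  skew system, and \<open>fuel\<close> keeps completed plus remaining stages one above the set-pair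
  bound. Each remaining stage adds at most the probability that its search overlooks an existing
  edge.\<close>

lemma refine_prob:
  assumes ora: "gpise_oracle d U H ora" and U: "uniform_hypergraph d U H" and d: "d > 0"
    and S: "hitting_set U H S" "card S \<le> k"
    and E: "\<And>i. i < l \<Longrightarrow> E i \<in> H"
    and X: "\<And>i. i < l \<Longrightarrow> X i \<subseteq> U \<and> card (X i) \<le> k"
    and disj: "\<And>i. i < l \<Longrightarrow> E i \<inter> X i = {}"
    and meet: "\<And>i j. i < j \<Longrightarrow> j < l \<Longrightarrow> E i \<inter> X j \<noteq> {}"
    and fuel: "l + m = (k + 1) ^ d + 1"
  shows "measure_pmf.prob (run ora (refine d U k n m (E ` {..<l})) hist)
    {(S, hist). \<not> (hitting_set U H S \<and> card S \<le> k)} \<le> m * (1 - 1 / real d ^ d) ^ n"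
  using E X disj meet fuel
proof (induction m arbitrary: l E X hist)
  case 0
  have "finite U" using U by (simp add: uniform_hypergraph_def)
  \<comment> \<open>With no stages left, \<open>fuel\<close> gives
    \<open>l = (k + 1) ^ d + 1\<close>, contradicting the set-pair bound.\<close>
  have "l \<le> (k + 1) ^ d"
  proof (rule skew_set_pairs_bound[where A = E and B = X])
    show "finite (E i) \<and> card (E i) = d" if "i < l" for i
      using 0(1)[OF that] U by (auto simp: uniform_hypergraph_def intro: finite_subset)
    show "finite (X i) \<and> card (X i) \<le> k" if "i < l" for i
      using 0(2)[OF that] \<open>finite U\<close> by (auto intro: finite_subset)
  qed (use 0 in auto)
  then show ?case using 0 by simp
next
  case (Suc m)
  let ?B = "{(S, hist). \<not> (hitting_set U H S \<and> card S \<le> k)}"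
  define F where "F = E ` {..<l}"
  define Y where "Y = small_hitting_set U k F"
  have "F \<subseteq> H" using Suc.prems(1) by (auto simp: F_def)
  note Y = small_hitting_set[OF S this, folded Y_def]
  let ?\<delta> = "(1 - 1 / real d ^ d) ^ n :: real"
  have "1 / real d ^ d \<le> (1::real)" using d by simp
  then have \<delta>0: "0 \<le> ?\<delta>" by simp
  show ?case
  proof (cases "hitting_set U H Y")
    case True
    \<comment> \<open>If \<open>Y\<close> hits all of \<open>H\<close>, no edge lies in
      \<open>U - Y\<close>; the search surely returns \<open>None\<close> and \<open>Y\<close> is
      output.\<close>
    have "set_pmf (run ora (refine d U k n (Suc m) F) hist) \<inter> ?B = {}"
    proof (rule ccontr)
      assume "\<not> ?thesis"
      then obtain x where x: "x \<in> set_pmf (run ora (refine d U k n (Suc m) F) hist)" "x \<in> ?B"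
        by blast
      then obtain r Q where
        r: "x \<in> set_pmf (run ora (case r of None \<Rightarrow> Output Y
            | Some E \<Rightarrow> refine d U k n m (insert E F)) (Q @ hist))"
        and "\<forall>E. r = Some E \<longrightarrow> E \<in> H \<and> E \<subseteq> U - Y"
        using find_edge_support[OF ora Diff_subset x(1)[unfolded refine.simps]] unfolding Y_def by blast
      with True have "r = None"
        by (cases r) (auto simp: hitting_set_def)
      then show False using r x(2) True Y by auto
    qed
    then have "measure_pmf.prob (run ora (refine d U k n (Suc m) F) hist) ?B = 0"
      by (simp add: measure_pmf_zero_iff)
    then show ?thesis using \<delta>0 by (simp add: F_def)
  next
    case False
    moreover have "Y \<subseteq> U" using Y by (simp add: hitting_set_def)
    ultimately obtain E0 where "E0 \<in> H" "E0 \<inter> Y = {}" by (auto simp: hitting_set_def)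
    with U have E0: "E0 \<in> H" "E0 \<subseteq> U - Y" by (auto simp: uniform_hypergraph_def)
    have "measure_pmf.prob (run ora (refine d U k n m (insert E1 F)) hist) ?B \<le> m * ?\<delta>"
      if E1: "E1 \<in> H" "E1 \<subseteq> U - Y" for E1 hist
    proof -
      \<comment> \<open>The new pair keeps the system skew: \<open>E1\<close> avoids
        \<open>Y\<close>, while \<open>Y\<close> hits \<open>F\<close>, that is, all earlier
        edges.\<close>
      define E' where "E' = E(l := E1)"
      define X' where "X' = X(l := Y)"
      have F': "insert E1 F = E' ` {..<Suc l}"
        by (auto simp: F_def E'_def lessThan_Suc)
      show ?thesis unfolding F'
      proof (rule Suc.IH)
        show "E' i \<in> H" if "i < Suc l" for i
          using that E1 Suc.prems(1) by (auto simp: E'_def less_Suc_eq)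
        show "X' i \<subseteq> U \<and> card (X' i) \<le> k" if "i < Suc l" for i
          using that Y Suc.prems(2) by (auto simp: X'_def less_Suc_eq hitting_set_def)
        show "E' i \<inter> X' i = {}" if "i < Suc l" for i
          using that E1 Suc.prems(3) by (auto simp: E'_def X'_def less_Suc_eq)
        show "E' i \<inter> X' j \<noteq> {}" if "i < j" "j < Suc l" for i j
          using that Y Suc.prems(4)[of i j] by (auto simp: E'_def X'_def less_Suc_eq hitting_set_def F_def)
        show "Suc l + m = (k + 1) ^ d + 1" using Suc.prems(5) by simp
      qed
    qed
    then have "measure_pmf.prob (run ora (refine d U k n (Suc m) F) hist) ?B \<le> m * ?\<delta> + ?\<delta>"
      unfolding refine.simps Y_def[symmetric]
      by (intro find_edge_prob[OF ora U Diff_subset d E0]) simp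
    then show ?thesis by (simp add: F_def algebra_simps)
  qed
qed

section \<open>Choice of parameters: failure probability and growth of the query count\<close>

text \<open>The exponent \<open>2 * d + 2\<close> pays \<open>2 * d\<close> for
  \<open>k + 1 \<le> k ^ 2\<close>, one for the extra stage (\<open>2 \<le> k\<close>), and one for
  the remaining \<open>1 / k\<close>.\<close>

lemma failure_bound:
  fixes k d n :: nat
  assumes "k \<ge> 2" "d > 0" and n: "real n \<ge> (2 * d + 2) * d ^ d * ln k"
  shows "((k + 1) ^ d + 1) * (1 - 1 / real d ^ d) ^ n \<le> 1 / k"
proof -
  have "(1 - 1 / real d ^ d) ^ n \<le> exp (- (1 / real d ^ d)) ^ n"
    using exp_ge_add_one_self[of "- (1 / real d ^ d)"] assms by (intro power_mono) auto
  also have "\<dots> = exp (- (n / d ^ d))" by (simp flip: exp_of_nat_mult)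
  also have "\<dots> \<le> exp (- ((2 * d + 2) * ln k))"
    using n assms(2) by (simp add: field_simps)
  also have "\<dots> = 1 / real k ^ (2 * d + 2)"
    using assms exp_of_nat_mult[of "2 * d + 2" "ln k"]
    by (simp add: exp_minus inverse_eq_divide del: power_Suc power_add)
  finally have 1: "(1 - 1 / real d ^ d) ^ n \<le> 1 / real k ^ (2 * d + 2)" .
  have "k + 1 \<le> k ^ 2" using assms(1) mult_le_mono1[OF assms(1), of k] unfolding power2_eq_square by linarith
  then have "(k + 1) ^ d + 1 \<le> k ^ (2 * d) + 1" using power_mono[of "k+1" "k^2" d] by (simp add: power_mult)
  also have "\<dots> \<le> 2 * k ^ (2 * d)" using assms by simp
  also have "\<dots> \<le> k ^ (2 * d + 1)" using assms by simp
  finally have 2: "real ((k + 1) ^ d + 1) \<le> real k ^ (2 * d + 1)"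
    by (metis of_nat_le_iff of_nat_power)
  have "((k + 1) ^ d + 1) * (1 - 1 / real d ^ d) ^ n \<le> real k ^ (2 * d + 1) * (1 / real k ^ (2 * d + 2))"
    using 1 2 assms(2) by (intro mult_mono) auto
  also have "\<dots> = 1 / k" using assms by (simp add: field_simps)
  finally show ?thesis .
qed

lemma query_bound_bigo:
  fixes C :: real
  assumes "C > 0"
  shows "(\<lambda>k. real (((k + 1) ^ d + 1) * nat \<lceil>C * ln (real k)\<rceil>)) \<in> O(\<lambda>k. real k ^ d * ln (real k))"
proof (rule bigoI)
  show "\<forall>\<^sub>F k in sequentially. norm (real (((k + 1) ^ d + 1) * nat \<lceil>C * ln (real k)\<rceil>))
    \<le> (2 ^ d + 1) * (C + 2) * norm (real k ^ d * ln (real k))"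
    \<comment> \<open>From 3 on, \<open>ln k \<ge> 1\<close> because \<open>exp 1 \<le> 3\<close>;
      this absorbs the rounding up of the number of tries.\<close>
    using eventually_ge_at_top[of 3]
  proof eventually_elim
    case (elim k)
    have ln1: "ln (real k) \<ge> 1"
      using elim exp_le by (subst ln_ge_iff) auto
    have "real (nat \<lceil>C * ln (real k)\<rceil>) \<le> C * ln k + 1"
      using assms ln1 by (simp add: of_nat_nat)
    also have "\<dots> \<le> (C + 2) * ln k" using ln1 by (simp add: algebra_simps)
    finally have 1: "real (nat \<lceil>C * ln (real k)\<rceil>) \<le> (C + 2) * ln k" .
    have "real (k + 1) ^ d \<le> (2 * real k) ^ d" using elim by (intro power_mono) auto
    moreover have "1 \<le> real k ^ d" using elim by simp
    ultimately have 2: "real ((k + 1) ^ d + 1) \<le> (2 ^ d + 1) * real k ^ d"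
      by (simp add: power_mult_distrib algebra_simps)
    have "real ((k + 1) ^ d + 1) * real (nat \<lceil>C * ln (real k)\<rceil>)
      \<le> ((2 ^ d + 1) * real k ^ d) * ((C + 2) * ln k)"
      using 1 2 by (intro mult_mono) auto
    then show ?case using ln1 by (simp add: algebra_simps)
  qed
qed

theorem theorem7:
  fixes d :: nat
  assumes "d \<ge> 2"
  shows "\<exists>(alg :: 'v set \<Rightarrow> nat \<Rightarrow> 'v prog) (q :: nat \<Rightarrow> nat) (c :: real).
    c > 0 \<and> (\<lambda>k. real (q k)) \<in> O(\<lambda>k. real k ^ d * ln (real k)) \<and>
    (\<forall>U H k ora. uniform_hypergraph d U H \<and> k \<ge> 1 \<and>
       (\<exists>S. hitting_set U H S \<and> card S \<le> k) \<and> gpise_oracle d U H ora \<longrightarrow>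
       (\<forall>(S, hist) \<in> set_pmf (run ora (alg U k) []).
          length hist \<le> q k \<and> (\<forall>A\<in>set hist. gpise_query d U A)) \<and>
       measure_pmf.prob (run ora (alg U k) [])
          {(S, hist). hitting_set U H S \<and> card S \<le> k} \<ge> 1 - 1 / real k powr c)"
proof -
  \<comment> \<open>The constant required by \<open>failure_bound\<close>.\<close>
  define C :: real where "C = (2 * d + 2) * d ^ d"
  define n where "n k = nat \<lceil>C * ln (real k)\<rceil>" for k :: nat
  define m where "m k = (k + 1) ^ d + 1" for k :: nat
  define alg :: "'v set \<Rightarrow> nat \<Rightarrow> 'v prog" where "alg U k = refine d U k (n k) (m k) {}" for U k
  have C: "C > 0" using assms by (simp add: C_def add_pos_pos)
  have bigo: "(\<lambda>k. real (m k * n k)) \<in> O(\<lambda>k. real k ^ d * ln (real k))"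
    unfolding m_def n_def using query_bound_bigo[OF C] by simp
  have support: "\<forall>(S, hist) \<in> set_pmf (run ora (alg U k) []).
      length hist \<le> m k * n k \<and> (\<forall>A\<in>set hist. gpise_query d U A)"
    if "gpise_oracle d U H ora" for U H k ora
    using refine_support[OF that, of _ _ k "n k" "m k" "{}" "[]"] unfolding alg_def by auto
  have success: "measure_pmf.prob (run ora (alg U k) []) {(S, hist). hitting_set U H S \<and> card S \<le> k}
      \<ge> 1 - 1 / real k powr 1"
    if U: "uniform_hypergraph d U H" and k: "k \<ge> 1" and S: "hitting_set U H S" "card S \<le> k"
      and ora: "gpise_oracle d U H ora" for U H k ora S
  proof (cases "k = 1")
    case True
    \<comment> \<open>For \<open>k = 1\<close> the required probability \<open>1 - 1 / k\<close> is
      zero.\<close>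
    then show ?thesis by simp
  next
    case False
    then have k2: "k \<ge> 2" using k by simp
    let ?p = "measure_pmf.prob (run ora (alg U k) [])"
    let ?good = "{(S, hist). hitting_set U H S \<and> card S \<le> k}"
    let ?bad = "{(S, hist). \<not> (hitting_set U H S \<and> card S \<le> k)}"
    have "?p ?bad \<le> m k * (1 - 1 / real d ^ d) ^ n k"
      \<comment> \<open>The initial record is empty, \<open>l = 0\<close>, so the sequences of edges
        and sets are arbitrary.\<close>
      using refine_prob[OF ora U _ S, of 0 "\<lambda>_. {}" "\<lambda>_. {}" "m k" "n k" "[]"] assms
      by (simp add: alg_def m_def)
    also have "\<dots> \<le> 1 / k"
      using failure_bound[OF k2, of d "n k"] assms unfolding m_def
      by (simp add: n_def C_def of_nat_ceiling)
    finally have "?p ?bad \<le> 1 / k" .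
    moreover have "?bad = space (measure_pmf (run ora (alg U k) [])) - ?good" by auto
    then have "?p ?bad = 1 - ?p ?good"
      by (simp only: measure_pmf.prob_compl sets_measure_pmf UNIV_I)
    moreover have "real k powr 1 = k" using k by simp
    ultimately show ?thesis by simp
  qed
  show ?thesis
  proof (intro exI conjI allI impI)
    show "(1::real) > 0" by simp
    show "(\<lambda>k. real (m k * n k)) \<in> O(\<lambda>k. real k ^ d * ln (real k))" by (rule bigo)
  qed (use support success in blast)+
qed

end
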